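(* If $P$ does not lie on the (extended) sides of triangle $ABC$ or of its anticomplementary triangle, and not on a median of $ABC$, then there is a conic $\mathcal{C}_P$ on the points $A, B, C, P, Q, P', Q'$. This conic also passes through the points $$A_0P\cdot D_0Q',\quad B_0P\cdot E_0Q',\quad C_0P\cdot F_0Q',$$ and $$A'_0P'\cdot D_0Q,\quad B'_0P'\cdot E_0Q,\quad C'_0P'\cdot F_0Q.$$
   Context: Work in the extended Euclidean plane: the Euclidean plane together with the line at infinity $l_\infty$. Points on $l_\infty$ are called infinite, all other points ordinary. $XY$ denotes the line through $X$ and $Y$, and $l\cdot m$ the intersection point of lines $l$ and $m$. $ABC$ is a (nondegenerate) triangle with centroid $G$; medians are taken as full lines $AG, BG, CG$. $K$ (the complement map) is the homothety with center $G$ and ratio $-1/2$; the anticomplementary triangle of $ABC$ is $K^{-1}(ABC)$. $D_0,E_0,F_0$ are the midpoints of $BC,CA,AB$. $D=AP\cdot BC$, $E=BP\cdot CA$, $F=CP\cdot AB$ are the traces of $P$. $D_3,E_3,F_3$ are the reflections of $D,E,F$ in $D_0,E_0,F_0$ respectively; the lines $AD_3,BE_3,CF_3$ meet in a point $P'=\iota(P)$, the isotomic conjugate of $P$. Put $Q=K(P')$ and $Q'=K(P)$. $A_0,B_0,C_0$ are the midpoints of $EF, FD, DE$, and $A'_0,B'_0,C'_0$ are the midpoints of $E_3F_3, F_3D_3, D_3E_3$.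
   Formalization: If P is infinite, the lines A_0P and D_0Q' (and their analogues) coincide, so the first three points are undefined; likewise the last three if P' is infinite. They are claimed to exist and lie on the conic when P, respectively P', is ordinary; the seven-point conic is claimed in all cases. *)

theory Defs
  imports "HOL-Analysis.Analysis"
begin

text \<open>
  Points at infinity are the directions of lines, i.e. the one-dimensional linear subspaces
  of the plane (one for each class of parallel lines).
\<close>

typedef direction = "{L :: (real^2) set. subspace L \<and> dim L = 1}"
proof -
  have "dim (span {axis 1 1 :: real^2}) = 1"
    by (simp add: dim_insert)
  then show ?thesis
    by (intro exI[of _ "span {axis 1 1}"]) simp
qed

datatype epoint = Ord "real^2" | Inf direction

definition l_inf :: "epoint set" where
  "l_inf = range Inf"

definition is_line :: "epoint set \<Rightarrow> bool" where
  "is_line l \<longleftrightarrow>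
     l = l_inf \<or> (\<exists>a d. l = insert (Inf d) {Ord (a + v) | v. v \<in> Rep_direction d})"

text \<open>
  The values of \<open>join X X\<close> and of \<open>meet l l\<close> are unspecified.
\<close>

definition join :: "epoint \<Rightarrow> epoint \<Rightarrow> epoint set" where
  "join X Y = (THE l. is_line l \<and> X \<in> l \<and> Y \<in> l)"

definition meet :: "epoint set \<Rightarrow> epoint set \<Rightarrow> epoint" where
  "meet l m = (THE X. X \<in> l \<and> X \<in> m)"

text \<open>
  Only pairs of ordinary points have a midpoint.
\<close>

definition emidpoint :: "epoint \<Rightarrow> epoint \<Rightarrow> epoint" where
  "emidpoint X Y = (case (X, Y) of (Ord x, Ord y) \<Rightarrow> Ord (midpoint x y) | _ \<Rightarrow> undefined)"

text \<open>
  A homothety with nonzero ratio maps every line to a parallel line, so that its extension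
  fixes all points at infinity. The reflection in \<open>M\<close> is the homothety with ratio \<open>-1\<close>.
\<close>

fun homothety :: "real^2 \<Rightarrow> real \<Rightarrow> epoint \<Rightarrow> epoint" where
  "homothety M r (Ord x) = Ord (M + r *\<^sub>R (x - M))"
| "homothety M r (Inf d) = Inf d"

definition reflection :: "real^2 \<Rightarrow> epoint \<Rightarrow> epoint" where
  "reflection M = homothety M (-1)"

definition centroid :: "real^2 \<Rightarrow> real^2 \<Rightarrow> real^2 \<Rightarrow> real^2" where
  "centroid A B C = (1/3) *\<^sub>R (A + B + C)"

definition complement_map :: "real^2 \<Rightarrow> real^2 \<Rightarrow> real^2 \<Rightarrow> epoint \<Rightarrow> epoint" where
  "complement_map A B C = homothety (centroid A B C) (-1/2)"

text \<open>
  \<open>cevian_trace A B C P\<close> is the trace of \<open>P\<close> on the side opposite to the first vertex \<open>A\<close>;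
  the other two traces are obtained by permuting the vertices.
\<close>

definition cevian_trace :: "real^2 \<Rightarrow> real^2 \<Rightarrow> real^2 \<Rightarrow> epoint \<Rightarrow> epoint" where
  "cevian_trace A B C P = meet (join (Ord A) P) (join (Ord B) (Ord C))"

definition reflected_trace :: "real^2 \<Rightarrow> real^2 \<Rightarrow> real^2 \<Rightarrow> epoint \<Rightarrow> epoint" where
  "reflected_trace A B C P = reflection (midpoint B C) (cevian_trace A B C P)"

definition isotomic_conjugate :: "real^2 \<Rightarrow> real^2 \<Rightarrow> real^2 \<Rightarrow> epoint \<Rightarrow> epoint" where
  "isotomic_conjugate A B C P =
     (THE X. X \<in> join (Ord A) (reflected_trace A B C P)
           \<and> X \<in> join (Ord B) (reflected_trace B C A P)
           \<and> X \<in> join (Ord C) (reflected_trace C A B P))"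

text \<open>
  Homogeneous coordinates with respect to the embedding of the plane at height \<open>1\<close>.
\<close>

fun hom_coords :: "epoint \<Rightarrow> (real^3) set" where
  "hom_coords (Ord x) = {vector [t * x $ 1, t * x $ 2, t] | t. t \<noteq> 0}"
| "hom_coords (Inf d) = {vector [v $ 1, v $ 2, 0] | v. v \<in> Rep_direction d \<and> v \<noteq> 0}"

text \<open>
  Conics are nondegenerate and have real points. In the second condition \<open>\<exists>\<close> may be replaced
  by \<open>\<forall>\<close>, as the homogeneous coordinates of a point are proportional.
\<close>

definition is_conic :: "epoint set \<Rightarrow> bool" where
  "is_conic \<C> \<longleftrightarrow> \<C> \<noteq> {} \<and>
     (\<exists>M :: real^3^3. transpose M = M \<and> det M \<noteq> 0 \<and>
        \<C> = {X. \<exists>h \<in> hom_coords X. h \<bullet> (M *v h) = 0})"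

end

theory Submission
  imports Defs
begin

text \<open>
  In barycentric coordinates with respect to \<open>A\<close>, \<open>B\<close>, \<open>C\<close> the theorem becomes a handful of
  polynomial identities. Write \<open>P = (p : q : r)\<close>. The hypotheses on the sides, on the sides of
  the anticomplementary triangle and on the medians say that \<open>p\<close>, \<open>q\<close>, \<open>r\<close> are nonzero, that
  their pairwise sums are nonzero and that they are pairwise distinct. The points in question are
  \<open>P' = (qr : rp : pq)\<close>, \<open>Q' = (q+r : r+p : p+q)\<close> and \<open>Q = (p(q+r) : q(r+p) : r(p+q))\<close>.

  A conic through the vertices has an equation \<open>f yz + g zx + h xy = 0\<close>, and it passes through
  \<open>(x : y : z)\<close> with \<open>xyz \<noteq> 0\<close> exactly if the line with coefficients \<open>(f, g, h)\<close> passes through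
  the isotomic conjugate \<open>(1/x : 1/y : 1/z)\<close>. Hence the conic through \<open>A, B, C, P, P'\<close> is the
  isotomic image of the line \<open>PP'\<close>, which up to a common factor has the coefficients
  \<open>p(r\<^sup>2 - q\<^sup>2)\<close>, \<open>q(p\<^sup>2 - r\<^sup>2)\<close>, \<open>r(q\<^sup>2 - p\<^sup>2)\<close>. They are nonzero, which makes the conic
  nondegenerate (\<open>is_conic_circumconic\<close>), and the coordinates of \<open>Q\<close> and \<open>Q'\<close> satisfy its
  equation.

  For suitable coefficient vectors, the lines \<open>A\<^sub>0P\<close> and \<open>D\<^sub>0Q'\<close> have the cross product
  \<open>(r - q)(p + q + r)\<close> times
  \<open>(p(q+r), q(r-p), r(q-p))\<close> (\<open>joins_meet_on_conic\<close>). So they coincide exactly if \<open>P\<close> is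
  infinite, and otherwise they meet in a point that satisfies the equation of the conic. The other
  five points follow by symmetry. A cyclic permutation of the vertices permutes the three points of
  a triple and preserves the conic. Exchanging \<open>P\<close> and \<open>P'\<close> exchanges the two triples, because
  \<open>D\<^sub>3\<close>, \<open>E\<^sub>3\<close>, \<open>F\<^sub>3\<close> are the traces of \<open>P'\<close>, and it also preserves the conic, since the line
  \<open>PP'\<close> stays the same.

  What remains is to justify the calculation: the incidence geometry of points and lines of the
  extended plane is that of the real projective plane, with joins and meets given by cross products
  of barycentric coordinates (\<open>is_line_iff_bary_line\<close>, \<open>join_bary\<close>, \<open>meet_bary_line\<close>).
\<close>

unbundle cross3_syntax

section \<open>Homogeneous coordinates of the extended plane\<close>

definition direction_of :: "real^2 \<Rightarrow> direction" where
  "direction_of v = Abs_direction (span {v})"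

text \<open>
  Parallelism in the plane is the vanishing of a determinant.
\<close>

lemma span_singleton_iff:
  fixes v w :: "real^2"
  assumes "v \<noteq> 0"
  shows "w \<in> span {v} \<longleftrightarrow> v $ 2 * w $ 1 = v $ 1 * w $ 2"
proof
  assume "w \<in> span {v}"
  then obtain k where "w = k *\<^sub>R v"
    unfolding span_singleton by blast
  then show "v $ 2 * w $ 1 = v $ 1 * w $ 2"
    by simp
next
  assume eq: "v $ 2 * w $ 1 = v $ 1 * w $ 2"
  define n where "n = v $ 1 * v $ 1 + v $ 2 * v $ 2"
  have n: "n \<noteq> 0"
    using assms by (simp add: n_def vec_eq_iff forall_2 sum_squares_eq_zero_iff)
  have "n * w $ 1 = (v $ 1 * w $ 1 + v $ 2 * w $ 2) * v $ 1"
    "n * w $ 2 = (v $ 1 * w $ 1 + v $ 2 * w $ 2) * v $ 2"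
    unfolding n_def using eq by algebra+
  then have "w = ((v $ 1 * w $ 1 + v $ 2 * w $ 2) / n) *\<^sub>R v"
    using n by (simp add: vec_eq_iff forall_2 field_simps)
  then show "w \<in> span {v}"
    unfolding span_singleton by blast
qed

lemma Rep_direction_of:
  assumes "v \<noteq> 0"
  shows "Rep_direction (direction_of v) = span {v}"
  unfolding direction_of_def
  by (rule Abs_direction_inverse) (use assms in \<open>simp add: dim_insert\<close>)

lemma direction_of_eq_iff:
  assumes "v \<noteq> 0"
  shows "direction_of v = d \<longleftrightarrow> v \<in> Rep_direction d"
proof
  assume "direction_of v = d"
  then show "v \<in> Rep_direction d"
    using Rep_direction_of[OF assms] by (auto intro: span_base)
next
  assume v: "v \<in> Rep_direction d"
  have d: "subspace (Rep_direction d)" "dim (Rep_direction d) = 1"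
    using Rep_direction[of d] by auto
  have "span {v} \<subseteq> Rep_direction d"
    using v d(1) by (simp add: span_minimal)
  then have "span {v} = Rep_direction d"
    by (rule subspace_dim_equal[rotated 2]) (use d assms in \<open>simp_all add: dim_insert\<close>)
  then show "direction_of v = d"
    by (simp add: direction_of_def Rep_direction_inverse)
qed

lemma direction_cases:
  obtains v where "v \<noteq> 0" "d = direction_of v"
proof -
  have "dim (Rep_direction d) = 1"
    using Rep_direction[of d] by auto
  then have "\<not> Rep_direction d \<subseteq> {0}"
    using dim_eq_0[of "Rep_direction d"] by simp
  then obtain v where "v \<in> Rep_direction d" "v \<noteq> 0"
    by blast
  then show thesis
    using that[of v] by (simp add: direction_of_eq_iff[THEN iffD2])
qed

text \<open>
  The zero vector does not represent a point; the value of \<open>hom_point\<close> there is arbitrary.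
\<close>

definition hom_point :: "real^3 \<Rightarrow> epoint" where
  "hom_point h = (if h $ 3 = 0 then Inf (direction_of (vector [h $ 1, h $ 2]))
                  else Ord (vector [h $ 1 / h $ 3, h $ 2 / h $ 3]))"

lemma hom_coords_iff: "h \<in> hom_coords X \<longleftrightarrow> h \<noteq> 0 \<and> hom_point h = X"
proof (cases X)
  case (Ord x)
  have "h \<in> hom_coords X \<longleftrightarrow> h $ 3 \<noteq> 0 \<and> vector [h $ 1 / h $ 3, h $ 2 / h $ 3] = x"
  proof
    assume "h \<in> hom_coords X"
    then obtain t where "h = vector [t * x $ 1, t * x $ 2, t]" "t \<noteq> 0"
      unfolding Ord by auto
    then show "h $ 3 \<noteq> 0 \<and> vector [h $ 1 / h $ 3, h $ 2 / h $ 3] = x"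
      by (simp add: vec_eq_iff forall_2)
  next
    assume r: "h $ 3 \<noteq> 0 \<and> vector [h $ 1 / h $ 3, h $ 2 / h $ 3] = x"
    then have "h = vector [h $ 3 * x $ 1, h $ 3 * x $ 2, h $ 3]"
      by (auto simp: vec_eq_iff forall_2 forall_3 field_simps)
    with r show "h \<in> hom_coords X"
      unfolding Ord hom_coords.simps by blast
  qed
  then show ?thesis
    by (auto simp: Ord hom_point_def)
next
  case (Inf d)
  define v :: "real^2" where "v = vector [h $ 1, h $ 2]"
  have nz: "v \<noteq> 0 \<longleftrightarrow> h \<noteq> 0" if "h $ 3 = 0"
    using that by (auto simp: v_def vec_eq_iff forall_2 forall_3)
  have eqv: "w = v" if "h = vector [w $ 1, w $ 2, 0]" for w :: "real^2"
    using that by (simp add: v_def vec_eq_iff forall_2 forall_3)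
  have "h \<in> hom_coords X \<longleftrightarrow> h $ 3 = 0 \<and> v \<noteq> 0 \<and> v \<in> Rep_direction d"
  proof
    assume "h \<in> hom_coords X"
    then obtain w where w: "h = vector [w $ 1, w $ 2, 0]" "w \<in> Rep_direction d" "w \<noteq> 0"
      unfolding Inf by auto
    then show "h $ 3 = 0 \<and> v \<noteq> 0 \<and> v \<in> Rep_direction d"
      using eqv[OF w(1)] by simp
  next
    assume r: "h $ 3 = 0 \<and> v \<noteq> 0 \<and> v \<in> Rep_direction d"
    then have "h = vector [v $ 1, v $ 2, 0]"
      by (simp add: v_def vec_eq_iff forall_3)
    with r show "h \<in> hom_coords X"
      unfolding Inf by auto
  qed
  then show ?thesis
    using nz direction_of_eq_iff[of v d] by (auto simp: Inf hom_point_def v_def)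
qed

lemma hom_coords_nonempty: "\<exists>h. h \<in> hom_coords X"
proof (cases X)
  case (Ord x)
  have "(vector [x $ 1, x $ 2, 1] :: real^3) \<in> hom_coords X"
    by (simp add: Ord hom_coords_iff hom_point_def vec_eq_iff forall_2 forall_3)
  then show ?thesis ..
next
  case (Inf d)
  obtain v where v: "v \<noteq> 0" "d = direction_of v"
    by (rule direction_cases)
  then have "v \<in> Rep_direction d"
    by (simp add: Rep_direction_of span_base)
  with v have "vector [v $ 1, v $ 2, 0] \<in> hom_coords X"
    unfolding Inf hom_coords.simps by blast
  then show ?thesis ..
qed

lemma hom_point_surj:
  obtains h where "h \<noteq> 0" "X = hom_point h"
  using hom_coords_nonempty[of X] that by (auto simp: hom_coords_iff)

lemma hom_point_eq_iff:
  assumes "h \<noteq> 0" "k \<noteq> 0"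
  shows "hom_point h = hom_point k \<longleftrightarrow> (\<exists>t. t \<noteq> 0 \<and> k = t *\<^sub>R h)"
proof
  assume eq: "hom_point h = hom_point k"
  show "\<exists>t. t \<noteq> 0 \<and> k = t *\<^sub>R h"
  proof (cases "h $ 3 = 0")
    case False
    then have "k $ 3 \<noteq> 0"
      using eq by (auto simp: hom_point_def split: if_splits)
    with False eq have "k = (k $ 3 / h $ 3) *\<^sub>R h"
      by (simp add: hom_point_def vec_eq_iff forall_2 forall_3 field_simps)
    with False \<open>k $ 3 \<noteq> 0\<close> show ?thesis
      by (intro exI[of _ "k $ 3 / h $ 3"]) simp
  next
    case True
    define v w :: "real^2" where "v = vector [h $ 1, h $ 2]" and "w = vector [k $ 1, k $ 2]"
    have k3: "k $ 3 = 0"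
      using eq True by (auto simp: hom_point_def split: if_splits)
    have nz: "v \<noteq> 0" "w \<noteq> 0"
      using assms True k3 by (auto simp: v_def w_def vec_eq_iff forall_2 forall_3)
    have "direction_of w = direction_of v"
      using eq True k3 by (simp add: hom_point_def v_def w_def)
    then have "w \<in> span {v}"
      using direction_of_eq_iff[OF nz(2)] Rep_direction_of[OF nz(1)] by simp
    then obtain t where t: "w = t *\<^sub>R v"
      unfolding span_singleton by blast
    then have "k = t *\<^sub>R h"
      using True k3 by (simp add: v_def w_def vec_eq_iff forall_2 forall_3)
    with nz(2) t show ?thesis
      by auto
  qed
next
  assume "\<exists>t. t \<noteq> 0 \<and> k = t *\<^sub>R h"
  then obtain t where t: "t \<noteq> 0" "k = t *\<^sub>R h"
    by blast
  show "hom_point h = hom_point k"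
  proof (cases "h $ 3 = 0")
    case True
    have "direction_of (vector [t * h $ 1, t * h $ 2]) = direction_of (vector [h $ 1, h $ 2])"
    proof -
      define v :: "real^2" where "v = vector [h $ 1, h $ 2]"
      have "v \<noteq> 0"
        using assms(1) True by (auto simp: v_def vec_eq_iff forall_2 forall_3)
      moreover have "vector [t * h $ 1, t * h $ 2] = t *\<^sub>R v"
        by (simp add: v_def vec_eq_iff forall_2)
      ultimately show ?thesis
        using t(1) by (simp add: direction_of_eq_iff Rep_direction_of span_base span_mul flip: v_def)
    qed
    then show ?thesis
      using True by (simp add: hom_point_def t(2))
  qed (use t in \<open>simp add: hom_point_def\<close>)
qed

definition hom_line :: "real^3 \<Rightarrow> epoint set" where
  "hom_line u = {hom_point h | h. h \<noteq> 0 \<and> u \<bullet> h = 0}"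

lemma hom_point_in_hom_line:
  assumes "h \<noteq> 0"
  shows "hom_point h \<in> hom_line u \<longleftrightarrow> u \<bullet> h = 0"
  using assms by (auto simp: hom_line_def hom_point_eq_iff)

lemma Ord_in_hom_line: "Ord x \<in> hom_line u \<longleftrightarrow> u $ 1 * x $ 1 + u $ 2 * x $ 2 + u $ 3 = 0"
proof -
  define h :: "real^3" where "h = vector [x $ 1, x $ 2, 1]"
  have "h \<noteq> 0"
    by (simp add: h_def vec_eq_iff forall_3)
  moreover have "hom_point h = Ord x"
    by (simp add: h_def hom_point_def vec_eq_iff forall_2)
  ultimately show ?thesis
    using hom_point_in_hom_line[of h u] by (simp add: h_def inner_vec_def sum_3)
qed

lemma Inf_in_hom_line:
  assumes "v \<noteq> 0"
  shows "Inf (direction_of v) \<in> hom_line u \<longleftrightarrow> u $ 1 * v $ 1 + u $ 2 * v $ 2 = 0"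
proof -
  define h :: "real^3" where "h = vector [v $ 1, v $ 2, 0]"
  have "h \<noteq> 0"
    using assms by (simp add: h_def vec_eq_iff forall_3 forall_2)
  moreover have "vector [v $ 1, v $ 2] = v"
    by (simp add: vec_eq_iff forall_2)
  then have "hom_point h = Inf (direction_of v)"
    by (simp add: h_def hom_point_def)
  ultimately show ?thesis
    using hom_point_in_hom_line[of h u] by (simp add: h_def inner_vec_def sum_3)
qed

lemma l_inf_eq_hom_line:
  assumes "w \<noteq> 0"
  shows "l_inf = hom_line (vector [0, 0, w])"
proof (rule set_eqI)
  show "X \<in> l_inf \<longleftrightarrow> X \<in> hom_line (vector [0, 0, w])" for X
  proof (cases X)
    case (Inf d)
    then show ?thesis
      by (metis Inf_in_hom_line add_0 direction_cases l_inf_def mult_zero_left rangeI vector_3(1,2))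
  qed (use assms in \<open>auto simp: l_inf_def Ord_in_hom_line\<close>)
qed

text \<open>
  The normal form of the line through \<open>a\<close> in the direction of \<open>v\<close>: the first two coefficients
  are a normal vector of \<open>v\<close>, and the third one is chosen such that \<open>a\<close> satisfies the equation.
\<close>

lemma ordinary_line_eq_hom_line:
  assumes "v \<noteq> 0"
  shows "insert (Inf (direction_of v)) {Ord (a + w) | w. w \<in> Rep_direction (direction_of v)}
       = hom_line (vector [v $ 2, - v $ 1, a $ 2 * v $ 1 - a $ 1 * v $ 2])" (is "?l = hom_line ?u")
proof (rule set_eqI)
  show "X \<in> ?l \<longleftrightarrow> X \<in> hom_line ?u" for X
  proof (cases X)
    case (Ord x)
    have "X \<in> ?l \<longleftrightarrow> x - a \<in> Rep_direction (direction_of v)"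
      unfolding Ord by (auto simp: algebra_simps) (metis add_diff_cancel_left' diff_add_cancel add.commute)
    then show ?thesis
      using assms by (simp add: Ord Ord_in_hom_line Rep_direction_of span_singleton_iff algebra_simps)
  next
    case (Inf d)
    obtain w where w: "w \<noteq> 0" "d = direction_of w"
      using direction_cases by blast
    then have "X \<in> ?l \<longleftrightarrow> w \<in> span {v}"
      using Inf by (auto simp: direction_of_eq_iff Rep_direction_of assms)
    then show ?thesis
      using assms w by (simp add: Inf Inf_in_hom_line span_singleton_iff)
  qed
qed

text \<open>
  This is the step from the extended Euclidean plane to the real projective plane: the line at
  infinity is the line whose first two coefficients vanish, and any other coefficient vector
  describes an ordinary line together with its direction.
\<close>

lemma is_line_iff_hom_line: "is_line l \<longleftrightarrow> (\<exists>u. u \<noteq> 0 \<and> l = hom_line u)"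
proof
  assume "is_line l"
  then consider "l = l_inf" | a d where "l = insert (Inf d) {Ord (a + v) | v. v \<in> Rep_direction d}"
    unfolding is_line_def by blast
  then show "\<exists>u. u \<noteq> 0 \<and> l = hom_line u"
  proof cases
    case 1
    then show ?thesis
      using l_inf_eq_hom_line[of 1]
      by (intro exI[of _ "vector [0, 0, 1]"]) (simp add: vec_eq_iff forall_3)
  next
    case 2
    obtain v where v: "v \<noteq> 0" "d = direction_of v"
      using direction_cases by blast
    then show ?thesis
      using 2 ordinary_line_eq_hom_line[OF v(1), of a]
      by (intro exI[of _ "vector [v $ 2, - v $ 1, a $ 2 * v $ 1 - a $ 1 * v $ 2]"])
        (auto simp: vec_eq_iff forall_2 forall_3)
  qed
next
  assume "\<exists>u. u \<noteq> 0 \<and> l = hom_line u"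
  then obtain u where u: "u \<noteq> 0" "l = hom_line u"
    by blast
  show "is_line l"
  proof (cases "u $ 1 = 0 \<and> u $ 2 = 0")
    case True
    then have "u = vector [0, 0, u $ 3]" "u $ 3 \<noteq> 0"
      using u(1) by (auto simp: vec_eq_iff forall_3)
    then show ?thesis
      using l_inf_eq_hom_line[of "u $ 3"] u(2) by (simp add: is_line_def)
  next
    case False
    define n where "n = u $ 1 * u $ 1 + u $ 2 * u $ 2"
    \<comment> \<open>\<open>v\<close> is orthogonal to the normal vector of the line, \<open>a\<close> is the point closest to the origin\<close>
    define v a :: "real^2" where "v = vector [- u $ 2, u $ 1]"
      and "a = vector [- u $ 1 * u $ 3 / n, - u $ 2 * u $ 3 / n]"
    have n: "n \<noteq> 0"
      using False by (simp add: n_def sum_squares_eq_zero_iff)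
    have v: "v \<noteq> 0"
      using False by (auto simp: v_def vec_eq_iff forall_2)
    have "a $ 2 * v $ 1 - a $ 1 * v $ 2 = (u $ 3 * n) / n"
      unfolding a_def v_def by (simp add: n_def add_divide_distrib algebra_simps)
    then have "vector [v $ 2, - v $ 1, a $ 2 * v $ 1 - a $ 1 * v $ 2] = u"
      using n by (simp add: v_def vec_eq_iff forall_3)
    then have "l = insert (Inf (direction_of v)) {Ord (a + w) | w. w \<in> Rep_direction (direction_of v)}"
      using ordinary_line_eq_hom_line[OF v, of a] u(2) by simp
    then show ?thesis
      unfolding is_line_def by blast
  qed
qed

section \<open>Barycentric coordinates\<close>

lemma vec3_eq_iff: "(a :: real^3) = b \<longleftrightarrow> a $ 1 = b $ 1 \<and> a $ 2 = b $ 2 \<and> a $ 3 = b $ 3"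
  by (simp add: vec_eq_iff forall_3)

lemma inner3: "(a :: real^3) \<bullet> b = a $ 1 * b $ 1 + a $ 2 * b $ 2 + a $ 3 * b $ 3"
  by (simp add: inner_vec_def sum_3)

lemma cross_eq_0_imp_scaleR:
  fixes u v :: "real^3"
  assumes "u \<times> v = 0" "u \<noteq> 0" "v \<noteq> 0"
  obtains t where "t \<noteq> 0" "v = t *\<^sub>R u"
  using assms by (auto simp: cross_eq_0 collinear_lemma)

text \<open>
  The columns are the homogeneous coordinates of the vertices at height \<open>1\<close>, so that the matrix
  takes barycentric to homogeneous coordinates.
\<close>

definition frame :: "real^2 \<Rightarrow> real^2 \<Rightarrow> real^2 \<Rightarrow> real^3^3" where
  "frame A B C = vector [vector [A $ 1, B $ 1, C $ 1], vector [A $ 2, B $ 2, C $ 2], vector [1, 1, 1]]"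

lemma frame_mult:
  "frame A B C *v c = vector [c $ 1 * A $ 1 + c $ 2 * B $ 1 + c $ 3 * C $ 1,
                              c $ 1 * A $ 2 + c $ 2 * B $ 2 + c $ 3 * C $ 2, c $ 1 + c $ 2 + c $ 3]"
  by (simp add: frame_def vec3_eq_iff matrix_vector_mult_def sum_3 mult.commute)

text \<open>
  The determinant is written in terms of two edge vectors because collinearity of the vertices
  amounts to linear dependence of these.
\<close>

lemma det_frame:
  "det (frame A B C) = (A - B) $ 2 * (C - B) $ 1 - (A - B) $ 1 * (C - B) $ 2"
  by (simp add: det_3 frame_def algebra_simps)

definition bary :: "real^2 \<Rightarrow> real^2 \<Rightarrow> real^2 \<Rightarrow> real^3 \<Rightarrow> epoint" where
  "bary A B C c = hom_point (frame A B C *v c)"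

definition bary_line :: "real^2 \<Rightarrow> real^2 \<Rightarrow> real^2 \<Rightarrow> real^3 \<Rightarrow> epoint set" where
  "bary_line A B C u = {bary A B C c | c. c \<noteq> 0 \<and> u \<bullet> c = 0}"

lemma bary_rotate: "bary B C A (vector [y, z, x]) = bary A B C (vector [x, y, z])"
  by (simp add: bary_def frame_mult algebra_simps)

text \<open>
  The symmetry argument in one place: a cyclic permutation of the vertices permutes the
  coordinates, so a locus given by an equation only has its equation permuted. Lines and
  circumscribed conics are the two instances.
\<close>

lemma Collect_bary_rotate:
  "{bary B C A c | c. c \<noteq> 0 \<and> \<phi> c} = {bary A B C c | c. c \<noteq> 0 \<and> \<phi> (vector [c $ 2, c $ 3, c $ 1])}"
  (is "?L = ?R")
proof (intro subset_antisym subsetI)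
  fix X assume "X \<in> ?L"
  then obtain c where c: "X = bary B C A c" "c \<noteq> 0" "\<phi> c"
    by blast
  define d :: "real^3" where "d = vector [c $ 3, c $ 1, c $ 2]"
  have "bary B C A c = bary A B C d"
    by (simp add: d_def bary_def frame_mult algebra_simps)
  moreover have "vector [d $ 2, d $ 3, d $ 1] = c"
    by (simp add: d_def vec3_eq_iff)
  moreover have "d \<noteq> 0"
    using c(2) by (auto simp: d_def vec3_eq_iff)
  ultimately show "X \<in> ?R"
    using c by auto
next
  fix X assume "X \<in> ?R"
  then obtain c where c: "X = bary A B C c" "c \<noteq> 0" "\<phi> (vector [c $ 2, c $ 3, c $ 1])"
    by blast
  define d :: "real^3" where "d = vector [c $ 2, c $ 3, c $ 1]"
  have "bary A B C c = bary B C A d"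
    by (simp add: d_def bary_def frame_mult algebra_simps)
  moreover have "d \<noteq> 0"
    using c(2) by (auto simp: d_def vec3_eq_iff)
  ultimately show "X \<in> ?L"
    using c by (auto simp flip: d_def)
qed

lemma bary_line_rotate:
  "bary_line B C A (vector [v, w, u]) = bary_line A B C (vector [u, v, w])"
  unfolding bary_line_def by (subst Collect_bary_rotate) (simp add: inner3 algebra_simps)

lemma bary_Ord:
  assumes "c $ 1 + c $ 2 + c $ 3 \<noteq> 0"
  shows "bary A B C c =
    Ord ((1 / (c $ 1 + c $ 2 + c $ 3)) *\<^sub>R (c $ 1 *\<^sub>R A + c $ 2 *\<^sub>R B + c $ 3 *\<^sub>R C))"
  using assms by (simp add: bary_def frame_mult hom_point_def vec_eq_iff forall_2)

lemma bary_in_l_inf: "bary A B C c \<in> l_inf \<longleftrightarrow> c $ 1 + c $ 2 + c $ 3 = 0"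
  by (auto simp: bary_def frame_mult hom_point_def l_inf_def)

lemma bary_vertex:
  "bary A B C (vector [1, 0, 0]) = Ord A"
  "bary A B C (vector [0, 1, 0]) = Ord B"
  "bary A B C (vector [0, 0, 1]) = Ord C"
  by (simp_all add: bary_Ord)

lemma bary_midpoint: "bary A B C (vector [0, 1, 1]) = Ord (midpoint B C)"
  by (simp add: bary_Ord midpoint_def)

lemma bary_centroid: "bary A B C (vector [1, 1, 1]) = Ord (centroid A B C)"
  by (simp add: bary_Ord centroid_def)

text \<open>
  The coordinate sums must be made equal before coordinates can be averaged, so each vector is
  weighted with the sum of the other.
\<close>

lemma emidpoint_bary:
  fixes a b :: "real^3"
  defines "s \<equiv> a $ 1 + a $ 2 + a $ 3" and "t \<equiv> b $ 1 + b $ 2 + b $ 3"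
  assumes nz: "s \<noteq> 0" "t \<noteq> 0"
  shows "emidpoint (bary A B C a) (bary A B C b) = bary A B C (t *\<^sub>R a + s *\<^sub>R b)"
proof -
  define c where "c = t *\<^sub>R a + s *\<^sub>R b"
  have sum: "c $ 1 + c $ 2 + c $ 3 = 2 * s * t"
    by (simp add: c_def s_def t_def algebra_simps)
  have "bary A B C c = Ord ((1 / (2 * s * t)) *\<^sub>R (c $ 1 *\<^sub>R A + c $ 2 *\<^sub>R B + c $ 3 *\<^sub>R C))"
    using nz by (subst bary_Ord) (simp_all add: sum)
  moreover have "midpoint ((1 / s) *\<^sub>R (a $ 1 *\<^sub>R A + a $ 2 *\<^sub>R B + a $ 3 *\<^sub>R C))
      ((1 / t) *\<^sub>R (b $ 1 *\<^sub>R A + b $ 2 *\<^sub>R B + b $ 3 *\<^sub>R C))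
    = (1 / (2 * s * t)) *\<^sub>R (c $ 1 *\<^sub>R A + c $ 2 *\<^sub>R B + c $ 3 *\<^sub>R C)"
    using nz by (simp add: vec_eq_iff midpoint_def c_def field_simps)
  moreover have "bary A B C a = Ord ((1 / s) *\<^sub>R (a $ 1 *\<^sub>R A + a $ 2 *\<^sub>R B + a $ 3 *\<^sub>R C))"
    "bary A B C b = Ord ((1 / t) *\<^sub>R (b $ 1 *\<^sub>R A + b $ 2 *\<^sub>R B + b $ 3 *\<^sub>R C))"
    using nz by (simp_all add: bary_Ord s_def t_def)
  ultimately show ?thesis
    by (simp add: emidpoint_def c_def)
qed

lemma reflection_bary:
  assumes "y + z \<noteq> 0"
  shows "reflection (midpoint B C) (bary A B C (vector [0, y, z])) = bary A B C (vector [0, z, y])"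
  using assms by (simp add: bary_Ord reflection_def midpoint_def vec_eq_iff divide_simps add.commute[of z y])
    (simp add: algebra_simps)

locale triangle =
  fixes A B C :: "real^2"
  assumes noncollinear: "\<not> collinear {A, B, C}"
begin

lemma rotate: "triangle B C A"
  using noncollinear by unfold_locales (simp add: insert_commute)

lemma det_frame_nonzero: "det (frame A B C) \<noteq> 0"
proof
  assume det: "det (frame A B C) = 0"
  have "\<not> collinear {0, A - B, C - B}"
    using noncollinear by (simp add: collinear_3)
  then have "A - B \<noteq> 0" "C - B \<notin> span {A - B}"
    by (auto simp: collinear_lemma span_singleton)
  then show False
    using det by (simp add: det_frame span_singleton_iff)
qed

lemma frame_inverse:
  obtains I where "frame A B C ** I = mat 1" "I ** frame A B C = mat 1"
  using det_frame_nonzero by (auto simp: invertible_def simp flip: invertible_det_nz)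

lemma frame_mult_surj: "\<exists>c. frame A B C *v c = h"
  by (metis frame_inverse matrix_vector_mul_assoc matrix_vector_mul_lid)

lemma frame_mult_inject [simp]: "frame A B C *v c = frame A B C *v d \<longleftrightarrow> c = d"
  by (metis frame_inverse matrix_vector_mul_assoc matrix_vector_mul_lid)

lemma frame_mult_eq_0_iff [simp]: "frame A B C *v c = 0 \<longleftrightarrow> c = 0"
  by (metis frame_mult_inject matrix_vector_mult_0_right)

lemma bary_cases:
  obtains p q r where "X = bary A B C (vector [p, q, r])" "(vector [p, q, r] :: real^3) \<noteq> 0"
proof -
  obtain h where h: "h \<noteq> 0" "X = hom_point h"
    by (rule hom_point_surj)
  obtain c where "frame A B C *v c = h"
    using frame_mult_surj by blast
  moreover have "c = vector [c $ 1, c $ 2, c $ 3]"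
    by (simp add: vec3_eq_iff)
  ultimately show thesis
    using h that by (metis bary_def matrix_vector_mult_0_right)
qed

lemma bary_eq_iff:
  assumes "c \<noteq> 0" "d \<noteq> 0"
  shows "bary A B C c = bary A B C d \<longleftrightarrow> (\<exists>t. t \<noteq> 0 \<and> d = t *\<^sub>R c)"
proof -
  have "frame A B C *v d = t *\<^sub>R (frame A B C *v c) \<longleftrightarrow> d = t *\<^sub>R c" for t
    by (metis frame_mult_inject matrix_vector_mult_scaleR)
  then show ?thesis
    using assms by (simp add: bary_def hom_point_eq_iff)
qed

lemma bary_scaleR:
  assumes "t \<noteq> 0"
  shows "bary A B C (t *\<^sub>R c) = bary A B C c"
  using assms bary_eq_iff[of c "t *\<^sub>R c"] by (cases "c = 0") auto

lemma bary_in_bary_line: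
  assumes "c \<noteq> 0"
  shows "bary A B C c \<in> bary_line A B C u \<longleftrightarrow> u \<bullet> c = 0"
  using assms by (auto simp: bary_line_def bary_eq_iff)

lemma bary_line_eq_hom_line: "bary_line A B C (transpose (frame A B C) *v u) = hom_line u"
proof (rule set_eqI)
  fix X
  obtain c where c: "c \<noteq> 0" "X = bary A B C c"
    by (metis bary_cases)
  have "(transpose (frame A B C) *v u) \<bullet> c = u \<bullet> (frame A B C *v c)"
    by (simp add: dot_lmul_matrix)
  then show "X \<in> bary_line A B C (transpose (frame A B C) *v u) \<longleftrightarrow> X \<in> hom_line u"
    using c bary_in_bary_line[OF c(1)] hom_point_in_hom_line[of "frame A B C *v c" u]
    by (simp add: bary_def)
qed

text \<open>
  A change of coordinates by the invertible frame matrix acts on coefficient vectors by its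
  transpose, so it takes the lines of one coordinate system to those of the other.
\<close>

lemma is_line_iff_bary_line: "is_line l \<longleftrightarrow> (\<exists>u. u \<noteq> 0 \<and> l = bary_line A B C u)"
proof -
  let ?T = "transpose (frame A B C)"
  obtain I where "?T ** I = mat 1" "I ** ?T = mat 1"
    by (metis frame_inverse matrix_transpose_mul transpose_mat)
  then have "\<exists>w. ?T *v w = u" "?T *v u = 0 \<longleftrightarrow> u = 0" for u
    by (metis matrix_vector_mul_assoc matrix_vector_mul_lid matrix_vector_mult_0_right)+
  then show ?thesis
    unfolding is_line_iff_hom_line by (metis bary_line_eq_hom_line)
qed

text \<open>
  The vectors \<open>u \<times> w\<close> are coordinates of points on the line \<open>u\<close>. If all of them lie on the line
  \<open>v\<close>, then \<open>u \<times> v\<close> is orthogonal to every \<open>w\<close>, hence it is zero.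
\<close>

lemma bary_line_eq_iff:
  assumes "u \<noteq> 0" "v \<noteq> 0"
  shows "bary_line A B C u = bary_line A B C v \<longleftrightarrow> u \<times> v = 0"
proof
  assume eq: "bary_line A B C u = bary_line A B C v"
  have "v \<bullet> (u \<times> w) = 0" for w
  proof (cases "u \<times> w = 0")
    case False
    have "bary A B C (u \<times> w) \<in> bary_line A B C u"
      using False by (simp add: bary_in_bary_line dot_cross_self)
    then show ?thesis
      using False unfolding eq by (simp add: bary_in_bary_line)
  qed simp
  then have "(u \<times> v) \<bullet> w = 0" for w
    using dot_cross_self cross_triple[of u v w] cross_triple[of v w u]
    by (metis cross_skew cross_triple inner_commute inner_minus_left)
  then show "u \<times> v = 0"
    using inner_eq_zero_iff by blast
next
  assume "u \<times> v = 0"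
  then obtain t where "t \<noteq> 0" "v = t *\<^sub>R u"
    using assms by (rule cross_eq_0_imp_scaleR)
  then show "bary_line A B C u = bary_line A B C v"
    by (simp add: bary_line_def)
qed

text \<open>
  The cross product is orthogonal to both factors, so it describes a line through both points.
  The identity of Lagrange shows that any other such line has a proportional coefficient vector.
\<close>

lemma join_bary:
  assumes "a \<times> b \<noteq> 0"
  shows "join (bary A B C a) (bary A B C b) = bary_line A B C (a \<times> b)"
proof -
  have nz: "a \<noteq> 0" "b \<noteq> 0"
    using assms by auto
  show ?thesis
    unfolding join_def
  proof (rule the_equality)
    show "is_line (bary_line A B C (a \<times> b)) \<and> bary A B C a \<in> bary_line A B C (a \<times> b)
        \<and> bary A B C b \<in> bary_line A B C (a \<times> b)"
      using assms nz by (auto simp: is_line_iff_bary_line bary_in_bary_line dot_cross_self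
          inner_commute[of "a \<times> b"])
  next
    fix l assume l: "is_line l \<and> bary A B C a \<in> l \<and> bary A B C b \<in> l"
    then obtain u where u: "u \<noteq> 0" "l = bary_line A B C u"
      by (auto simp: is_line_iff_bary_line)
    have "u \<times> (a \<times> b) = 0"
      using l nz by (simp add: u(2) bary_in_bary_line Lagrange)
    then show "l = bary_line A B C (a \<times> b)"
      using assms u by (simp add: bary_line_eq_iff)
  qed
qed

lemma meet_unique:
  assumes "u \<times> v \<noteq> 0"
  shows "X \<in> bary_line A B C u \<and> X \<in> bary_line A B C v \<longleftrightarrow> X = bary A B C (u \<times> v)"
proof
  assume X: "X \<in> bary_line A B C u \<and> X \<in> bary_line A B C v"
  then obtain c where c: "c \<noteq> 0" "X = bary A B C c" "u \<bullet> c = 0"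
    by (auto simp: bary_line_def)
  have "c \<times> (u \<times> v) = 0"
    using X c by (simp add: Lagrange bary_in_bary_line inner_commute)
  then obtain t where "t \<noteq> 0" "u \<times> v = t *\<^sub>R c"
    using c(1) assms by (rule cross_eq_0_imp_scaleR)
  then show "X = bary A B C (u \<times> v)"
    by (simp add: bary_scaleR c(2))
qed (use assms in \<open>simp add: bary_in_bary_line dot_cross_self\<close>)

lemma meet_bary_line:
  assumes "u \<times> v \<noteq> 0"
  shows "meet (bary_line A B C u) (bary_line A B C v) = bary A B C (u \<times> v)"
  unfolding meet_def meet_unique[OF assms] by (rule the_eq_trivial)

text \<open>
  For an infinite point the coordinate sum is \<open>0\<close>, and the new coordinates are the negatives of the
  old ones. So one formula covers the ordinary points and the infinite ones, which are fixed.
\<close>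

lemma complement_map_bary:
  assumes "(vector [x, y, z] :: real^3) \<noteq> 0"
  shows "complement_map A B C (bary A B C (vector [x, y, z]))
    = bary A B C (vector [y + z, z + x, x + y])"
proof (cases "x + y + z = 0")
  case False
  then have "y + z + (z + x) + (x + y) \<noteq> 0"
    by (simp add: algebra_simps)
  then show ?thesis
    using False by (simp add: bary_Ord complement_map_def centroid_def vec_eq_iff forall_2 divide_simps)
      (simp add: algebra_simps)
next
  case True
  then have "bary A B C (vector [x, y, z]) \<in> l_inf"
    by (simp add: bary_in_l_inf)
  then have "complement_map A B C (bary A B C (vector [x, y, z])) = bary A B C (vector [x, y, z])"
    by (auto simp: l_inf_def complement_map_def)
  also have "vector [y + z, z + x, x + y] = (-1) *\<^sub>R (vector [x, y, z] :: real^3)"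
    using True by (auto simp: vec3_eq_iff)
  then have "bary A B C (vector [x, y, z]) = bary A B C (vector [y + z, z + x, x + y])"
    by (simp only: bary_scaleR)
  finally show ?thesis .
qed

lemma cevian_trace_bary:
  assumes "y \<noteq> 0 \<or> z \<noteq> 0"
  shows "cevian_trace A B C (bary A B C (vector [x, y, z])) = bary A B C (vector [0, y, z])"
proof -
  have "join (Ord A) (bary A B C (vector [x, y, z])) = bary_line A B C (vector [0, - z, y])"
    using join_bary[of "vector [1, 0, 0]" "vector [x, y, z]"] assms
    by (auto simp: bary_vertex vec3_eq_iff cross_components cross3_def)
  moreover have "join (Ord B) (Ord C) = bary_line A B C (vector [1, 0, 0])"
    using join_bary[of "vector [0, 1, 0]" "vector [0, 0, 1]"]
    by (simp add: bary_vertex vec3_eq_iff cross3_def)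
  ultimately show ?thesis
    using meet_bary_line[of "vector [0, - z, y]" "vector [1, 0, 0]"] assms
    by (simp add: cevian_trace_def vec3_eq_iff cross3_def)
qed

end

section \<open>Circumscribed conics\<close>

text \<open>
  The coefficient vector \<open>w\<close> gives the barycentric coordinates of the perspector of the conic.
\<close>

definition circumconic :: "real^2 \<Rightarrow> real^2 \<Rightarrow> real^2 \<Rightarrow> real^3 \<Rightarrow> epoint set" where
  "circumconic A B C w = {bary A B C c | c. c \<noteq> 0 \<and>
     w $ 1 * (c $ 2 * c $ 3) + w $ 2 * (c $ 3 * c $ 1) + w $ 3 * (c $ 1 * c $ 2) = 0}"

text \<open>
  Up to the factor \<open>pqr\<close> this is the cross product of \<open>(1/p, 1/q, 1/r)\<close> with \<open>(p, q, r)\<close>, that is,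
  the line \<open>PP'\<close> whose isotomic image is the conic sought.
\<close>

definition perspector :: "real \<Rightarrow> real \<Rightarrow> real \<Rightarrow> real^3" where
  "perspector p q r = vector [p * (r\<^sup>2 - q\<^sup>2), q * (p\<^sup>2 - r\<^sup>2), r * (q\<^sup>2 - p\<^sup>2)]"

lemma circumconic_rotate:
  "circumconic B C A (vector [g, h, f]) = circumconic A B C (vector [f, g, h])"
  unfolding circumconic_def by (subst Collect_bary_rotate) (simp add: algebra_simps)

lemma circumconic_perspector_rotate: "circumconic B C A (perspector q r p) = circumconic A B C (perspector p q r)"
  unfolding perspector_def by (rule circumconic_rotate)

lemma circumconic_scaleR:
  assumes "t \<noteq> 0"
  shows "circumconic A B C (t *\<^sub>R w) = circumconic A B C w"
proof -
  have "(t *\<^sub>R w) $ 1 * x + (t *\<^sub>R w) $ 2 * y + (t *\<^sub>R w) $ 3 * z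
      = t * (w $ 1 * x + w $ 2 * y + w $ 3 * z)" for x y z
    by (simp add: algebra_simps)
  with assms show ?thesis
    by (simp only: circumconic_def mult_eq_0_iff) simp
qed

text \<open>
  The line \<open>PP'\<close> does not change if \<open>P\<close> and \<open>P'\<close> are exchanged; only the sign and the scaling of its
  coefficient vector do. Clearing denominators leaves the factor \<open>-pqr\<close>.
\<close>

lemma circumconic_perspector_isotomic:
  assumes "p \<noteq> 0" "q \<noteq> 0" "r \<noteq> 0"
  shows "circumconic A B C (perspector (q * r) (r * p) (p * q)) = circumconic A B C (perspector p q r)"
proof -
  have "perspector (q * r) (r * p) (p * q) = (- (p * q * r)) *\<^sub>R perspector p q r"
    by (simp add: perspector_def vec3_eq_iff power2_eq_square algebra_simps)
  then show ?thesis
    using assms circumconic_scaleR[of "- (p * q * r)"] by simp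
qed

context triangle
begin

lemma bary_in_circumconic:
  assumes "c \<noteq> 0"
  shows "bary A B C c \<in> circumconic A B C w \<longleftrightarrow>
    w $ 1 * (c $ 2 * c $ 3) + w $ 2 * (c $ 3 * c $ 1) + w $ 3 * (c $ 1 * c $ 2) = 0"
    (is "_ \<longleftrightarrow> ?q c = 0")
proof -
  have "?q (t *\<^sub>R d) = t\<^sup>2 * ?q d" for t d
    by (simp add: power2_eq_square algebra_simps)
  with assms show ?thesis
    by (auto simp: circumconic_def bary_eq_iff)
qed

text \<open>
  In barycentric coordinates the symmetric matrix of the form has determinant \<open>2 w\<^sub>1 w\<^sub>2 w\<^sub>3\<close>. The
  inverse of the frame matrix carries the form over to homogeneous coordinates and keeps it
  symmetric and nondegenerate.
\<close>

lemma is_conic_circumconic: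
  assumes "w $ 1 \<noteq> 0" "w $ 2 \<noteq> 0" "w $ 3 \<noteq> 0"
  shows "is_conic (circumconic A B C w)"
proof -
  define S :: "real^3^3" where
    "S = vector [vector [0, w $ 3, w $ 2], vector [w $ 3, 0, w $ 1], vector [w $ 2, w $ 1, 0]]"
  obtain I where I: "frame A B C ** I = mat 1" "I ** frame A B C = mat 1"
    by (rule frame_inverse)
  define M where "M = transpose I ** S ** I"
  have "transpose S = S"
    by (simp add: S_def transpose_def vec_eq_iff forall_3)
  then have sym: "transpose M = M"
    by (simp add: M_def matrix_transpose_mul matrix_mul_assoc)
  have "det S = 2 * w $ 1 * w $ 2 * w $ 3"
    by (simp add: S_def det_3)
  moreover have "det I * det (frame A B C) = 1"
    by (metis I(2) det_I det_mul)
  ultimately have det: "det M \<noteq> 0"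
    using assms by (auto simp: M_def det_mul)
  have form: "(frame A B C *v c) \<bullet> (M *v (frame A B C *v c))
      = 2 * (w $ 1 * (c $ 2 * c $ 3) + w $ 2 * (c $ 3 * c $ 1) + w $ 3 * (c $ 1 * c $ 2))" for c
  proof -
    have cancel: "I *v (frame A B C *v c) = c"
      by (simp add: matrix_vector_mul_assoc I(2))
    have "(frame A B C *v c) \<bullet> (M *v (frame A B C *v c))
        = (frame A B C *v c) \<bullet> (transpose I *v (S *v c))"
      by (metis M_def cancel matrix_vector_mul_assoc)
    also have "\<dots> = (I *v (frame A B C *v c)) \<bullet> (S *v c)"
      by (simp add: inner_commute[of "frame A B C *v c"] dot_lmul_matrix inner_commute[of "S *v c"])
    also have "\<dots> = c \<bullet> (S *v c)"
      by (simp add: cancel)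
    also have "\<dots> = 2 * (w $ 1 * (c $ 2 * c $ 3) + w $ 2 * (c $ 3 * c $ 1) + w $ 3 * (c $ 1 * c $ 2))"
      by (simp add: S_def inner3 matrix_vector_mult_def sum_3 algebra_simps)
    finally show ?thesis .
  qed
  have "X \<in> circumconic A B C w \<longleftrightarrow> (\<exists>h \<in> hom_coords X. h \<bullet> (M *v h) = 0)" for X
  proof
    assume "X \<in> circumconic A B C w"
    then obtain c where "X = bary A B C c" "c \<noteq> 0"
        "w $ 1 * (c $ 2 * c $ 3) + w $ 2 * (c $ 3 * c $ 1) + w $ 3 * (c $ 1 * c $ 2) = 0"
      by (auto simp: circumconic_def)
    then show "\<exists>h \<in> hom_coords X. h \<bullet> (M *v h) = 0"
      by (intro bexI[of _ "frame A B C *v c"]) (simp_all add: form hom_coords_iff bary_def)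
  next
    assume "\<exists>h \<in> hom_coords X. h \<bullet> (M *v h) = 0"
    then obtain h where h: "h \<in> hom_coords X" "h \<bullet> (M *v h) = 0"
      by blast
    obtain c where hc: "h = frame A B C *v c"
      using frame_mult_surj by metis
    then have "c \<noteq> 0" "X = bary A B C c"
      using h(1) by (auto simp: hom_coords_iff bary_def)
    then show "X \<in> circumconic A B C w"
      using h(2) form[of c] by (simp add: hc bary_in_circumconic)
  qed
  moreover have "Ord A \<in> circumconic A B C w"
    using bary_in_circumconic[of "vector [1, 0, 0]" w] by (simp add: bary_vertex vec3_eq_iff)
  ultimately show ?thesis
    unfolding is_conic_def using sym det by blast
qed

end

section \<open>The isotomic conjugate and the complement\<close>

lemma complement_map_rotate: "complement_map B C A = complement_map A B C"
  by (simp add: complement_map_def centroid_def algebra_simps)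

context triangle
begin

text \<open>
  The definite description in the definition of the isotomic conjugate is justified here: the
  lines \<open>AD\<^sub>3\<close> and \<open>BE\<^sub>3\<close> are distinct and so meet in a single point, which also lies on \<open>CF\<^sub>3\<close>.
\<close>

lemma isotomic_conjugate_bary:
  assumes "p \<noteq> 0" "q \<noteq> 0" "r \<noteq> 0" "p + q \<noteq> 0" "q + r \<noteq> 0" "r + p \<noteq> 0"
  shows "isotomic_conjugate A B C (bary A B C (vector [p, q, r]))
    = bary A B C (vector [q * r, r * p, p * q])"
proof -
  \<comment> \<open>stated for an arbitrary triangle, to be used for all three cyclic permutations\<close>
  have line: "join (Ord A) (reflected_trace A B C (bary A B C (vector [p, q, r])))
      = bary_line A B C (vector [0, - q, r])"
    if "triangle A B C" "q \<noteq> 0" "q + r \<noteq> 0" for A B C p q r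
  proof -
    interpret t: triangle A B C by (rule that)
    have "reflected_trace A B C (bary A B C (vector [p, q, r])) = bary A B C (vector [0, r, q])"
      using that by (simp add: reflected_trace_def t.cevian_trace_bary reflection_bary)
    then show ?thesis
      using t.join_bary[of "vector [1, 0, 0]" "vector [0, r, q]"] that(2)
      by (simp add: bary_vertex cross3_def vec3_eq_iff)
  qed
  interpret B: triangle B C A by (rule rotate)
  have lineA: "join (Ord A) (reflected_trace A B C (bary A B C (vector [p, q, r])))
      = bary_line A B C (vector [0, - q, r])"
    using line[OF triangle_axioms] assms by simp
  have lineB: "join (Ord B) (reflected_trace B C A (bary A B C (vector [p, q, r])))
      = bary_line A B C (vector [p, 0, - r])"
    using line[OF rotate, of r p q] assms by (simp add: bary_rotate bary_line_rotate)
  have lineC: "join (Ord C) (reflected_trace C A B (bary A B C (vector [p, q, r])))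
      = bary_line A B C (vector [- p, q, 0])"
    using line[OF B.rotate, of p q r] assms by (simp add: bary_rotate bary_line_rotate)
  have cross: "vector [0, - q, r] \<times> vector [p, 0, - r] = (vector [q * r, r * p, p * q] :: real^3)"
    by (simp add: cross3_def vec3_eq_iff)
  have nz: "(vector [q * r, r * p, p * q] :: real^3) \<noteq> 0"
    using assms by (simp add: vec3_eq_iff)
  have "X \<in> bary_line A B C (vector [0, - q, r]) \<and> X \<in> bary_line A B C (vector [p, 0, - r])
      \<and> X \<in> bary_line A B C (vector [- p, q, 0])
      \<longleftrightarrow> X = bary A B C (vector [q * r, r * p, p * q])" for X
    using meet_unique[of "vector [0, - q, r]" "vector [p, 0, - r]" X] nz
    by (auto simp: cross bary_in_bary_line inner3)
  then show ?thesis
    by (simp add: isotomic_conjugate_def lineA lineB lineC)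
qed

text \<open>
  Both points are \<open>(0 : r : q)\<close>. This turns the statement about \<open>A'\<^sub>0\<close>, \<open>B'\<^sub>0\<close>, \<open>C'\<^sub>0\<close> into the one
  about \<open>A\<^sub>0\<close>, \<open>B\<^sub>0\<close>, \<open>C\<^sub>0\<close> for \<open>P'\<close> in place of \<open>P\<close>.
\<close>

lemma reflected_trace_eq_trace_of_isotomic:
  assumes "p \<noteq> 0" "q \<noteq> 0" "r \<noteq> 0" "q + r \<noteq> 0"
  shows "reflection (midpoint B C) (cevian_trace A B C (bary A B C (vector [p, q, r])))
    = cevian_trace A B C (bary A B C (vector [q * r, r * p, p * q]))"
proof -
  have "bary A B C (vector [0, r * p, p * q]) = bary A B C (vector [0, r, q])"
  proof -
    have "vector [0, r * p, p * q] = p *\<^sub>R (vector [0, r, q] :: real^3)"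
      by (simp add: vec3_eq_iff)
    then show ?thesis
      using assms by (simp only: bary_scaleR not_False_eq_True)
  qed
  then show ?thesis
    using assms by (simp add: cevian_trace_bary reflection_bary)
qed

text \<open>
  The two lines have coefficient vectors \<open>u\<close> and \<open>v\<close> below, and \<open>u \<times> v\<close> contains the factor
  \<open>p + q + r\<close>, which vanishes exactly for infinite \<open>P\<close>. The cofactor \<open>X\<close> lies on the conic because of
  \<open>(r - q) - (p + r) + (q + p) = 0\<close>: as long as the coordinates of \<open>X\<close> are nonzero, its three terms
  are those of the equation divided by the product of the coordinates, and the resulting polynomial
  identity holds without this restriction.
\<close>

lemma joins_meet_on_conic:
  fixes p q r :: real
  defines "P \<equiv> bary A B C (vector [p, q, r])"
  assumes nz: "p \<noteq> 0" "q \<noteq> 0" "r \<noteq> 0" "p + q \<noteq> 0" "q + r \<noteq> 0" "r + p \<noteq> 0" "q \<noteq> r"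
  defines "l \<equiv> join (emidpoint (cevian_trace B C A P) (cevian_trace C A B P)) P"
    and "m \<equiv> join (Ord (midpoint B C)) (complement_map A B C P)"
  shows "(P \<notin> l_inf \<longrightarrow> l \<noteq> m) \<and> (l \<noteq> m \<longrightarrow> meet l m \<in> circumconic A B C (perspector p q r))"
proof -
  interpret B: triangle B C A by (rule rotate)
  interpret C: triangle C A B by (rule B.rotate)
  define u v X :: "real^3"
    where "u = vector [q * r * (r - q), - (r * p * (p + r)), p * q * (p + q)]"
      and "v = vector [q - r, q + r, - (q + r)]"
      and "X = vector [p * (q + r), q * (r - p), r * (q - p)]"
  have E: "cevian_trace B C A P = bary A B C (vector [p, 0, r])"
    using B.cevian_trace_bary[of r p q] nz by (simp add: P_def bary_rotate)
  have F: "cevian_trace C A B P = bary A B C (vector [p, q, 0])"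
    using C.cevian_trace_bary[of p q r] nz by (simp add: P_def bary_rotate)
  have "(p + q) *\<^sub>R vector [p, 0, r] + (p + r) *\<^sub>R vector [p, q, 0]
      = (vector [p * (2 * p + q + r), q * (p + r), r * (p + q)] :: real^3)"
    by (simp add: vec3_eq_iff algebra_simps)
  then have A0: "emidpoint (cevian_trace B C A P) (cevian_trace C A B P)
      = bary A B C (vector [p * (2 * p + q + r), q * (p + r), r * (p + q)])"
    using nz unfolding E F by (subst emidpoint_bary) (simp_all add: add.commute)
  have "vector [p * (2 * p + q + r), q * (p + r), r * (p + q)] \<times> vector [p, q, r] = u"
    by (simp add: u_def cross3_def vec3_eq_iff algebra_simps)
  moreover have u: "u \<noteq> 0"
    using nz by (simp add: u_def vec3_eq_iff)
  ultimately have l: "l = bary_line A B C u"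
    unfolding l_def A0 unfolding P_def by (metis join_bary)
  have Q': "complement_map A B C P = bary A B C (vector [q + r, r + p, p + q])"
    using nz unfolding P_def by (subst complement_map_bary) (simp_all add: vec3_eq_iff)
  have "vector [0, 1, 1] \<times> vector [q + r, r + p, p + q] = v"
    by (simp add: v_def cross3_def vec3_eq_iff)
  moreover have v: "v \<noteq> 0"
    using nz by (simp add: v_def vec3_eq_iff)
  ultimately have m: "m = bary_line A B C v"
    unfolding m_def Q' bary_midpoint[of A B C, symmetric] using join_bary by metis
  have uv: "u \<times> v = ((r - q) * (p + q + r)) *\<^sub>R X"
    by (simp add: u_def v_def X_def cross3_def vec3_eq_iff algebra_simps)
  have X: "X \<noteq> 0"
    using nz by (simp add: X_def vec3_eq_iff)
  have lm: "l \<noteq> m \<longleftrightarrow> p + q + r \<noteq> 0"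
    using nz X by (simp add: l m bary_line_eq_iff u v uv)
  have "P \<notin> l_inf \<longrightarrow> l \<noteq> m"
    unfolding lm by (simp add: P_def bary_in_l_inf)
  moreover have "meet l m \<in> circumconic A B C (perspector p q r)" if "l \<noteq> m"
  proof -
    have s: "(r - q) * (p + q + r) \<noteq> 0"
      using that lm nz by simp
    then have "meet l m = bary A B C X"
      unfolding l m using X by (subst meet_bary_line) (simp_all add: uv bary_scaleR)
    moreover have "bary A B C X \<in> circumconic A B C (perspector p q r)"
      using X by (simp add: bary_in_circumconic)
        (simp add: X_def perspector_def power2_eq_square algebra_simps)
    ultimately show ?thesis
      by simp
  qed
  ultimately show ?thesis
    by blast
qed

lemma not_in_join_bary:
  assumes "a \<times> b \<noteq> 0" "c \<noteq> 0"
  shows "bary A B C c \<notin> join (bary A B C a) (bary A B C b) \<longleftrightarrow> (a \<times> b) \<bullet> c \<noteq> 0"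
  using assms by (simp add: join_bary bary_in_bary_line)

text \<open>
  The vertices of the anticomplementary triangle, whose side \<open>y + z = 0\<close>, for example, is the
  parallel to \<open>BC\<close> through \<open>A\<close>.
\<close>

lemma inv_complement_map_vertex:
  "inv (complement_map A B C) (Ord A) = bary A B C (vector [-1, 1, 1])"
  "inv (complement_map A B C) (Ord B) = bary A B C (vector [1, -1, 1])"
  "inv (complement_map A B C) (Ord C) = bary A B C (vector [1, 1, -1])"
proof -
  have "inj (complement_map A B C)"
  proof (rule injI)
    show "X = Y" if "complement_map A B C X = complement_map A B C Y" for X Y
      using that by (cases X; cases Y) (auto simp: complement_map_def)
  qed
  then show "inv (complement_map A B C) (Ord A) = bary A B C (vector [-1, 1, 1])"
    "inv (complement_map A B C) (Ord B) = bary A B C (vector [1, -1, 1])"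
    "inv (complement_map A B C) (Ord C) = bary A B C (vector [1, 1, -1])"
    by (auto intro!: inv_f_eq simp: bary_Ord complement_map_def centroid_def vec_eq_iff field_simps)
qed

end

section \<open>The conic through the seven points and the six intersection points\<close>

theorem theorem2p1:
  fixes A B C D0 E0 F0 G :: "real^2"
    and P P' Q Q' D E F D3 E3 F3 A0 B0 C0 A0' B0' C0' :: epoint
    and K :: "epoint \<Rightarrow> epoint"
  assumes triangle: "\<not> collinear {A, B, C}"
    and G: "G = centroid A B C"
    and K: "K = complement_map A B C"
    and sides: "P \<notin> join (Ord B) (Ord C)" "P \<notin> join (Ord C) (Ord A)" "P \<notin> join (Ord A) (Ord B)"
    and anticomplementary_sides:
      "P \<notin> join (inv K (Ord B)) (inv K (Ord C))"
      "P \<notin> join (inv K (Ord C)) (inv K (Ord A))"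
      "P \<notin> join (inv K (Ord A)) (inv K (Ord B))"
    and medians: "P \<notin> join (Ord A) (Ord G)" "P \<notin> join (Ord B) (Ord G)" "P \<notin> join (Ord C) (Ord G)"
    and midpoints: "D0 = midpoint B C" "E0 = midpoint C A" "F0 = midpoint A B"
    and traces: "D = cevian_trace A B C P" "E = cevian_trace B C A P" "F = cevian_trace C A B P"
    and reflected_traces: "D3 = reflection D0 D" "E3 = reflection E0 E" "F3 = reflection F0 F"
    and P': "P' = isotomic_conjugate A B C P"
    and Q: "Q = K P'"
    and Q': "Q' = K P"
    and "A0 = emidpoint E F" "B0 = emidpoint F D" "C0 = emidpoint D E"
    and "A0' = emidpoint E3 F3" "B0' = emidpoint F3 D3" "C0' = emidpoint D3 E3"
  shows "\<exists>\<C>. is_conic \<C> \<and> {Ord A, Ord B, Ord C, P, Q, P', Q'} \<subseteq> \<C> \<and>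
    (\<forall>(l, m) \<in> {(join A0 P, join (Ord D0) Q'),
                 (join B0 P, join (Ord E0) Q'),
                 (join C0 P, join (Ord F0) Q')}.
        (P \<notin> l_inf \<longrightarrow> l \<noteq> m) \<and> (l \<noteq> m \<longrightarrow> meet l m \<in> \<C>)) \<and>
    (\<forall>(l, m) \<in> {(join A0' P', join (Ord D0) Q),
                 (join B0' P', join (Ord E0) Q),
                 (join C0' P', join (Ord F0) Q)}.
        (P' \<notin> l_inf \<longrightarrow> l \<noteq> m) \<and> (l \<noteq> m \<longrightarrow> meet l m \<in> \<C>))"
proof -
  interpret triangle A B C
    by (rule triangle.intro) (rule triangle)
  interpret B: triangle B C A by (rule rotate)
  interpret C: triangle C A B by (rule B.rotate)
  obtain p q r where P_eq: "P = bary A B C (vector [p, q, r])"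
    and P_nz: "(vector [p, q, r] :: real^3) \<noteq> 0"
    by (rule bary_cases)
  have nz: "p \<noteq> 0" "q \<noteq> 0" "r \<noteq> 0"
    using sides not_in_join_bary[OF _ P_nz, of "vector [0, 1, 0]" "vector [0, 0, 1]"]
      not_in_join_bary[OF _ P_nz, of "vector [0, 0, 1]" "vector [1, 0, 0]"]
      not_in_join_bary[OF _ P_nz, of "vector [1, 0, 0]" "vector [0, 1, 0]"]
    by (simp_all add: P_eq bary_vertex cross3_def inner3 vec3_eq_iff)
  have sums: "q + r \<noteq> 0" "r + p \<noteq> 0" "p + q \<noteq> 0"
    using anticomplementary_sides
      not_in_join_bary[OF _ P_nz, of "vector [1, -1, 1]" "vector [1, 1, -1]"]
      not_in_join_bary[OF _ P_nz, of "vector [1, 1, -1]" "vector [-1, 1, 1]"]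
      not_in_join_bary[OF _ P_nz, of "vector [-1, 1, 1]" "vector [1, -1, 1]"]
    by (simp_all add: P_eq K inv_complement_map_vertex cross3_def inner3 vec3_eq_iff)
  have distinct: "q \<noteq> r" "r \<noteq> p" "p \<noteq> q"
    using medians not_in_join_bary[OF _ P_nz, of "vector [1, 0, 0]" "vector [1, 1, 1]"]
      not_in_join_bary[OF _ P_nz, of "vector [0, 1, 0]" "vector [1, 1, 1]"]
      not_in_join_bary[OF _ P_nz, of "vector [0, 0, 1]" "vector [1, 1, 1]"]
    by (simp_all add: P_eq G bary_vertex bary_centroid cross3_def inner3 vec3_eq_iff)
  \<comment> \<open>everything said about \<open>p, q, r\<close> carries over to the coordinates of \<open>P'\<close>\<close>
  define p' q' r' where "p' = q * r" and "q' = r * p" and "r' = p * q"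
  have nz': "p' \<noteq> 0" "q' \<noteq> 0" "r' \<noteq> 0"
    using nz by (simp_all add: p'_def q'_def r'_def)
  have "q' + r' = p * (q + r)" "r' + p' = q * (r + p)" "p' + q' = r * (p + q)"
    by (simp_all add: p'_def q'_def r'_def algebra_simps)
  then have sums': "q' + r' \<noteq> 0" "r' + p' \<noteq> 0" "p' + q' \<noteq> 0"
    using nz sums by simp_all
  have distinct': "q' \<noteq> r'" "r' \<noteq> p'" "p' \<noteq> q'"
    using nz distinct by (simp_all add: p'_def q'_def r'_def mult.commute)
  have P'_eq: "P' = bary A B C (vector [p', q', r'])"
    using isotomic_conjugate_bary[of p q r] nz sums by (simp add: P' P_eq p'_def q'_def r'_def add.commute)
  define \<C> where "\<C> = circumconic A B C (perspector p q r)"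
  have \<C>': "\<C> = circumconic A B C (perspector p' q' r')"
    using circumconic_perspector_isotomic[OF nz] by (simp add: \<C>_def p'_def q'_def r'_def)
  have reflected: "D3 = cevian_trace A B C P'" "E3 = cevian_trace B C A P'" "F3 = cevian_trace C A B P'"
    using reflected_trace_eq_trace_of_isotomic[of p q r]
      B.reflected_trace_eq_trace_of_isotomic[of q r p]
      C.reflected_trace_eq_trace_of_isotomic[of r p q] nz sums
    by (simp_all add: reflected_traces midpoints traces P_eq P'_eq p'_def q'_def r'_def bary_rotate)
  have "is_conic \<C>"
    unfolding \<C>_def
    by (rule is_conic_circumconic) (use nz sums distinct in \<open>auto simp: perspector_def power2_eq_iff add_eq_0_iff\<close>)
  moreover have "{Ord A, Ord B, Ord C, P, Q, P', Q'} \<subseteq> \<C>"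
  proof -
    have "Ord A \<in> \<C>" "Ord B \<in> \<C>" "Ord C \<in> \<C>"
      unfolding \<C>_def bary_vertex[of A B C, symmetric]
      by (subst bary_in_circumconic; simp add: vec3_eq_iff)+
    moreover have "P \<in> \<C>" "P' \<in> \<C>"
      unfolding \<C>_def P_eq P'_eq p'_def q'_def r'_def using nz
      by (subst bary_in_circumconic; simp add: vec3_eq_iff perspector_def power2_eq_square algebra_simps)+
    moreover have "Q' = bary A B C (vector [q + r, r + p, p + q])"
      unfolding Q' K P_eq using P_nz by (rule complement_map_bary)
    then have "Q' \<in> \<C>"
      unfolding \<C>_def using sums
      by (simp add: bary_in_circumconic vec3_eq_iff)
         (simp add: perspector_def power2_eq_square algebra_simps)
    moreover have "Q = bary A B C (vector [q' + r', r' + p', p' + q'])"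
      unfolding Q K P'_eq by (rule complement_map_bary) (use nz' in \<open>simp add: vec3_eq_iff\<close>)
    then have "Q \<in> \<C>"
      unfolding \<C>' using sums'
      by (simp add: bary_in_circumconic vec3_eq_iff)
         (simp add: perspector_def power2_eq_square algebra_simps)
    ultimately show ?thesis
      by simp
  qed
  moreover
  let ?good = "\<lambda>X l m. (X \<notin> l_inf \<longrightarrow> l \<noteq> m) \<and> (l \<noteq> m \<longrightarrow> meet l m \<in> \<C>)"
  have "?good P (join A0 P) (join (Ord D0) Q')" "?good P (join B0 P) (join (Ord E0) Q')"
    "?good P (join C0 P) (join (Ord F0) Q')"
    unfolding assms(25-27) midpoints traces Q' K P_eq \<C>_def
    using joins_meet_on_conic[of p q r] B.joins_meet_on_conic[of q r p]
      C.joins_meet_on_conic[of r p q] nz sums distinct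
    by (simp_all add: bary_rotate circumconic_perspector_rotate complement_map_rotate)
  moreover have "?good P' (join A0' P') (join (Ord D0) Q)" "?good P' (join B0' P') (join (Ord E0) Q)"
    "?good P' (join C0' P') (join (Ord F0) Q)"
    unfolding assms(28-30) reflected midpoints Q K P'_eq \<C>'
    using joins_meet_on_conic[of p' q' r'] B.joins_meet_on_conic[of q' r' p']
      C.joins_meet_on_conic[of r' p' q'] nz' sums' distinct'
    by (simp_all add: bary_rotate circumconic_perspector_rotate complement_map_rotate)
  ultimately show ?thesis
    by (intro exI[of _ \<C>]) simp
qed

end
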